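(* Let $G_1$ and $G_2$ be finite t-groups with $\gcd(|G_1|,|G_2|)=1$. Then the direct product $G_1\times G_2$ is a t-group.
   Context: All groups are finite. Let $G$ be a finite group and $H\le G$. A normalized right transversal (NRT) of $H$ in $G$ is a subset $S\subseteq G$ containing exactly one element from each right coset of $H$ in $G$ and with $1\in S$. $\mathcal{T}(G,H)$ denotes the set of all NRTs of $H$ in $G$. Each NRT $S$ carries the binary operation $\circ$ defined by $\{x\circ y\}=S\cap Hxy$, which makes $S$ a right loop with identity $1$. Two NRTs (possibly of different subgroups) are isomorphic, written $S_1\cong S_2$, if there is a bijection between them preserving these operations. For a divisor $d$ of $|G|$, the transiso graph $\Gamma_d(G)$ is the simple graph whose vertices are the subgroups of $G$ of order $d$, two distinct vertices $H_1,H_2$ being adjacent if and only if there exist $S_1\in\mathcal{T}(G,H_1)$ and $S_2\in\mathcal{T}(G,H_2)$ with $S_1\cong S_2$. A graph is complete if any two distinct vertices are adjacent (so graphs with at most one vertex are complete). A finite group $G$ is a t-group if $\Gamma_d(G)$ is complete for every divisor $d$ of $|G|$. *)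

theory Defs
  imports "HOL-Algebra.Algebra" "HOL-Library.Ramsey"
begin

definition NRT :: "('a, 'b) monoid_scheme \<Rightarrow> 'a set \<Rightarrow> 'a set set"
  where "NRT G H = {S. S \<subseteq> carrier G \<and> \<one>\<^bsub>G\<^esub> \<in> S \<and> (\<forall>C \<in> rcosets\<^bsub>G\<^esub> H. \<exists>!s. s \<in> S \<inter> C)}"

text \<open>The right loop carried by a transversal. It is packaged as a \<^typ>\<open>'a monoid\<close> record only for
  its signature; the operation need not be associative. An isomorphism \<^term>\<open>L \<cong> M\<close> of such records
  is by definition just a bijection of the carriers that preserves the operation.\<close>

definition NRT_loop :: "('a, 'b) monoid_scheme \<Rightarrow> 'a set \<Rightarrow> 'a set \<Rightarrow> 'a monoid"
  where "NRT_loop G H S =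
    \<lparr>carrier = S, monoid.mult = (\<lambda>x y. THE z. z \<in> S \<inter> (H #>\<^bsub>G\<^esub> (x \<otimes>\<^bsub>G\<^esub> y))), one = \<one>\<^bsub>G\<^esub>\<rparr>"

lemma NRT_loop_mult:
  assumes "group G" "S \<in> NRT G H" "x \<in> S" "y \<in> S"
  shows "{x \<otimes>\<^bsub>NRT_loop G H S\<^esub> y} = S \<inter> (H #>\<^bsub>G\<^esub> (x \<otimes>\<^bsub>G\<^esub> y))"
proof -
  interpret group G by fact
  have "x \<otimes>\<^bsub>G\<^esub> y \<in> carrier G"
    using assms(2-4) by (auto simp: NRT_def)
  then have "H #>\<^bsub>G\<^esub> (x \<otimes>\<^bsub>G\<^esub> y) \<in> rcosets\<^bsub>G\<^esub> H"
    by (auto simp: RCOSETS_def)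
  then have ex1: "\<exists>!z. z \<in> S \<inter> (H #>\<^bsub>G\<^esub> (x \<otimes>\<^bsub>G\<^esub> y))"
    using assms(2) by (simp add: NRT_def)
  show ?thesis
    using theI'[OF ex1] ex1 by (simp add: NRT_loop_def) blast
qed

definition transiso_verts :: "('a, 'b) monoid_scheme \<Rightarrow> nat \<Rightarrow> 'a set set"
  where "transiso_verts G d = {H. subgroup H G \<and> card H = d}"

definition transiso_edges :: "('a, 'b) monoid_scheme \<Rightarrow> nat \<Rightarrow> 'a set set set"
  where "transiso_edges G d = {{H\<^sub>1, H\<^sub>2} | H\<^sub>1 H\<^sub>2.
    H\<^sub>1 \<in> transiso_verts G d \<and> H\<^sub>2 \<in> transiso_verts G d \<and> H\<^sub>1 \<noteq> H\<^sub>2 \<and>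
    (\<exists>S\<^sub>1 \<in> NRT G H\<^sub>1. \<exists>S\<^sub>2 \<in> NRT G H\<^sub>2. NRT_loop G H\<^sub>1 S\<^sub>1 \<cong> NRT_loop G H\<^sub>2 S\<^sub>2)}"

text \<open>A graph is complete when its whole vertex set is a \<^const>\<open>clique\<close>: any two distinct vertices
  are joined by an edge.\<close>

definition t_group :: "('a, 'b) monoid_scheme \<Rightarrow> bool"
  where "t_group G \<longleftrightarrow> group G \<and> finite (carrier G) \<and>
    (\<forall>d. d dvd order G \<longrightarrow> clique (transiso_verts G d) (transiso_edges G d))"

end

theory Submission
  imports Defs
begin

text \<open>Coprimality makes every subgroup of the product a product of its two projections, and two
  subgroups of the same order then have projections of the same orders. Transversals of the factors
  multiply to a transversal of the product whose right loop is the direct product of the right loops,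
  so isomorphisms can be chosen factorwise; where the two projections coincide, any transversal of
  that subgroup does.\<close>

text \<open>Adjacency with the condition \<open>H \<noteq> K\<close> dropped and the pair ordered.
  Admitting equal subgroups lets a product with one coinciding projection be treated like any
  other.\<close>

definition transiso :: "('a, 'b) monoid_scheme \<Rightarrow> 'a set \<Rightarrow> 'a set \<Rightarrow> bool"
  where "transiso G H K \<longleftrightarrow> (\<exists>S \<in> NRT G H. \<exists>T \<in> NRT G K. NRT_loop G H S \<cong> NRT_loop G K T)"

section \<open>Right loops of transversals\<close>

lemma carrier_NRT_loop [simp]: "carrier (NRT_loop G H S) = S"
  by (simp add: NRT_loop_def)

lemma NRT_loop_mult_eqI:
  assumes "group G" "S \<in> NRT G H" "x \<in> S" "y \<in> S" "z \<in> S" "z \<in> H #>\<^bsub>G\<^esub> (x \<otimes>\<^bsub>G\<^esub> y)"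
  shows "x \<otimes>\<^bsub>NRT_loop G H S\<^esub> y = z"
proof -
  have "z \<in> {x \<otimes>\<^bsub>NRT_loop G H S\<^esub> y}"
    unfolding NRT_loop_mult[OF assms(1-4)] using assms(5,6) by blast
  then show ?thesis by simp
qed

lemma NRT_loop_mult_mem:
  assumes "group G" "S \<in> NRT G H" "x \<in> S" "y \<in> S"
  shows "x \<otimes>\<^bsub>NRT_loop G H S\<^esub> y \<in> S" "x \<otimes>\<^bsub>NRT_loop G H S\<^esub> y \<in> H #>\<^bsub>G\<^esub> (x \<otimes>\<^bsub>G\<^esub> y)"
  using NRT_loop_mult[OF assms] by blast+

text \<open>These loops need not be groups, so symmetry is checked directly: products of elements of
  \<open>S\<close> stay in \<open>S\<close>, and this carries the homomorphism equation over to the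
  inverse bijection.\<close>

lemma NRT_loop_iso_sym:
  assumes G: "group G" and S: "S \<in> NRT G H" and iso: "NRT_loop G H S \<cong> NRT_loop G K T"
  shows "NRT_loop G K T \<cong> NRT_loop G H S"
proof -
  let ?L = "NRT_loop G H S" and ?M = "NRT_loop G K T"
  obtain f where bij: "bij_betw f S T"
    and hom: "\<And>x y. x \<in> S \<Longrightarrow> y \<in> S \<Longrightarrow> f (x \<otimes>\<^bsub>?L\<^esub> y) = f x \<otimes>\<^bsub>?M\<^esub> f y"
    using iso by (auto simp: is_iso_def iso_def hom_def)
  define g where "g = inv_into S f"
  have g_mem: "g x \<in> S" and fg: "f (g x) = x" if "x \<in> T" for x
    using bij that by (auto simp: g_def bij_betw_def inv_into_into f_inv_into_f)
  have gf: "g (f x) = x" if "x \<in> S" for x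
    using bij that by (simp add: g_def bij_betw_def)
  have "g (x \<otimes>\<^bsub>?M\<^esub> y) = g x \<otimes>\<^bsub>?L\<^esub> g y" if "x \<in> T" "y \<in> T" for x y
    by (metis that g_mem fg gf hom NRT_loop_mult_mem(1)[OF G S])
  moreover have "bij_betw g T S"
    using bij by (simp add: g_def bij_betw_inv_into)
  ultimately have "g \<in> iso ?M ?L"
    using g_mem by (auto simp: iso_def hom_def)
  then show ?thesis
    by (rule is_isoI)
qed

section \<open>From complete graphs to a relation on subgroups\<close>

lemma transiso_sym: "group G \<Longrightarrow> transiso G H K \<Longrightarrow> transiso G K H"
  unfolding transiso_def using NRT_loop_iso_sym by blast

lemma NRT_nonempty:
  assumes "group G" "subgroup H G"
  shows "NRT G H \<noteq> {}"
proof -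
  interpret group G by fact
  interpret H: subgroup H G by fact
  \<comment> \<open>The coset \<open>H\<close> itself is represented by the identity, which makes
    the transversal normalized; every other coset gets an arbitrary representative.\<close>
  define c where "c C = (if C = H then \<one>\<^bsub>G\<^esub> else SOME x. x \<in> C)" for C
  have c: "c C \<in> C" if "C \<in> rcosets\<^bsub>G\<^esub> H" for C
    using H.rcosets_non_empty[OF that] by (auto simp: c_def some_in_eq)
  have "\<exists>!s. s \<in> c ` (rcosets\<^bsub>G\<^esub> H) \<inter> C" if C: "C \<in> rcosets\<^bsub>G\<^esub> H" for C
  proof (rule ex1I[of _ "c C"])
    show "c C \<in> c ` (rcosets\<^bsub>G\<^esub> H) \<inter> C"
      using c C by blast
    show "s = c C" if s: "s \<in> c ` (rcosets\<^bsub>G\<^esub> H) \<inter> C" for s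
    proof -
      obtain D where D: "D \<in> rcosets\<^bsub>G\<^esub> H" "s = c D" "s \<in> C"
        using s by blast
      then have "\<not> disjnt D C"
        using c by (auto simp: disjnt_iff)
      then have "D = C"
        using pairwiseD[OF rcos_disjoint[OF assms(2)] D(1) C] by blast
      then show ?thesis using D(2) by simp
    qed
  qed
  moreover have "\<one>\<^bsub>G\<^esub> \<in> c ` (rcosets\<^bsub>G\<^esub> H)"
    using H.subgroup_in_rcosets[OF assms(1)] by (auto simp: c_def image_iff)
  moreover have "c ` (rcosets\<^bsub>G\<^esub> H) \<subseteq> carrier G"
    using c rcosets_part_G[OF assms(2)] by blast
  ultimately have "c ` (rcosets\<^bsub>G\<^esub> H) \<in> NRT G H"
    by (simp add: NRT_def)
  then show ?thesis by blast
qed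

lemma transiso_refl: "group G \<Longrightarrow> subgroup H G \<Longrightarrow> transiso G H H"
  using NRT_nonempty[of G H] by (force simp: transiso_def)

text \<open>Reflexivity makes the diagonal harmless, and symmetry allows an edge to be read in
  either direction.\<close>

lemma clique_transiso_iff:
  assumes "group G"
  shows "clique (transiso_verts G d) (transiso_edges G d) \<longleftrightarrow>
    (\<forall>H \<in> transiso_verts G d. \<forall>K \<in> transiso_verts G d. transiso G H K)"
  unfolding clique_def
proof (intro ball_cong refl)
  fix H K
  assume HK: "H \<in> transiso_verts G d" "K \<in> transiso_verts G d"
  show "(H \<noteq> K \<longrightarrow> {H, K} \<in> transiso_edges G d) \<longleftrightarrow> transiso G H K"
  proof (cases "H = K")
    case True
    then show ?thesis
      using HK assms by (simp add: transiso_verts_def transiso_refl)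
  next
    case False
    \<comment> \<open>An edge is an unordered pair, so the witnesses in its definition may occur in
      either order.\<close>
    have "{H, K} \<in> transiso_edges G d \<longleftrightarrow> transiso G H K \<or> transiso G K H"
      using HK False by (auto simp: transiso_edges_def simp flip: transiso_def simp: doubleton_eq_iff)
    then show ?thesis
      using False transiso_sym[OF assms] by blast
  qed
qed

text \<open>By Lagrange every subgroup order divides the group order, so the quantifier over
  \<open>d\<close> can be absorbed into the condition that two subgroups have equal order.\<close>

lemma t_group_iff:
  "t_group G \<longleftrightarrow> group G \<and> finite (carrier G) \<and>
    (\<forall>H K. subgroup H G \<and> subgroup K G \<and> card H = card K \<longrightarrow> transiso G H K)"
proof -
  have "(\<forall>d. d dvd order G \<longrightarrow> clique (transiso_verts G d) (transiso_edges G d)) \<longleftrightarrow>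
    (\<forall>H K. subgroup H G \<and> subgroup K G \<and> card H = card K \<longrightarrow> transiso G H K)"
    if G: "group G"
  proof -
    have "card H dvd order G" if "subgroup H G" for H
      using group.lagrange[OF G that] by (metis dvd_triv_right)
    then show ?thesis
      unfolding clique_transiso_iff[OF G] by (auto simp: transiso_verts_def)
  qed
  then show ?thesis
    unfolding t_group_def by blast
qed

section \<open>Transversals of a direct product\<close>

lemma r_coset_DirProd:
  "(H\<^sub>1 \<times> H\<^sub>2) #>\<^bsub>G\<^sub>1 \<times>\<times> G\<^sub>2\<^esub> (x, y) = (H\<^sub>1 #>\<^bsub>G\<^sub>1\<^esub> x) \<times> (H\<^sub>2 #>\<^bsub>G\<^sub>2\<^esub> y)"
  by (auto simp: r_coset_def)

text \<open>Cosets of a product subgroup are products of cosets, so the transversal meets each of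
  them in a product of two singletons.\<close>

lemma NRT_DirProd:
  assumes "S\<^sub>1 \<in> NRT G\<^sub>1 H\<^sub>1" "S\<^sub>2 \<in> NRT G\<^sub>2 H\<^sub>2"
  shows "S\<^sub>1 \<times> S\<^sub>2 \<in> NRT (G\<^sub>1 \<times>\<times> G\<^sub>2) (H\<^sub>1 \<times> H\<^sub>2)"
proof -
  have "\<exists>!s. s \<in> (S\<^sub>1 \<times> S\<^sub>2) \<inter> C" if "C \<in> rcosets\<^bsub>G\<^sub>1 \<times>\<times> G\<^sub>2\<^esub> (H\<^sub>1 \<times> H\<^sub>2)" for C
  proof -
    obtain x y where xy: "x \<in> carrier G\<^sub>1" "y \<in> carrier G\<^sub>2"
      and C: "C = (H\<^sub>1 #>\<^bsub>G\<^sub>1\<^esub> x) \<times> (H\<^sub>2 #>\<^bsub>G\<^sub>2\<^esub> y)"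
      using \<open>C \<in> _\<close> by (auto simp: RCOSETS_def r_coset_DirProd)
    have "\<exists>!s. s \<in> S\<^sub>1 \<inter> (H\<^sub>1 #>\<^bsub>G\<^sub>1\<^esub> x)" "\<exists>!s. s \<in> S\<^sub>2 \<inter> (H\<^sub>2 #>\<^bsub>G\<^sub>2\<^esub> y)"
      using assms xy by (auto simp: NRT_def RCOSETS_def)
    then obtain s t where "S\<^sub>1 \<inter> (H\<^sub>1 #>\<^bsub>G\<^sub>1\<^esub> x) = {s}" "S\<^sub>2 \<inter> (H\<^sub>2 #>\<^bsub>G\<^sub>2\<^esub> y) = {t}"
      by (metis (no_types, lifting) is_singletonI' is_singleton_the_elem ex_in_conv)
    then have "(S\<^sub>1 \<times> S\<^sub>2) \<inter> C = {(s, t)}"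
      by (simp add: C Times_Int_Times)
    then show ?thesis by simp
  qed
  then show ?thesis
    using assms by (auto simp: NRT_def)
qed

text \<open>The pair of loop products lies in the product transversal and in the right coset, so
  uniqueness of the representative identifies it. Hence \<open>map_prod\<close> of two loop
  isomorphisms is again one.\<close>

lemma NRT_loop_DirProd_mult:
  assumes G: "group G\<^sub>1" "group G\<^sub>2"
    and S: "S\<^sub>1 \<in> NRT G\<^sub>1 H\<^sub>1" "S\<^sub>2 \<in> NRT G\<^sub>2 H\<^sub>2"
    and "x \<in> S\<^sub>1" "x' \<in> S\<^sub>1" "y \<in> S\<^sub>2" "y' \<in> S\<^sub>2"
  shows "(x, y) \<otimes>\<^bsub>NRT_loop (G\<^sub>1 \<times>\<times> G\<^sub>2) (H\<^sub>1 \<times> H\<^sub>2) (S\<^sub>1 \<times> S\<^sub>2)\<^esub> (x', y') =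
    (x \<otimes>\<^bsub>NRT_loop G\<^sub>1 H\<^sub>1 S\<^sub>1\<^esub> x', y \<otimes>\<^bsub>NRT_loop G\<^sub>2 H\<^sub>2 S\<^sub>2\<^esub> y')"
  using assms NRT_loop_mult_mem[OF G(1) S(1)] NRT_loop_mult_mem[OF G(2) S(2)]
  by (intro NRT_loop_mult_eqI DirProd_group NRT_DirProd) (auto simp: r_coset_DirProd)

lemma transiso_DirProd:
  assumes G: "group G\<^sub>1" "group G\<^sub>2"
    and 1: "transiso G\<^sub>1 H\<^sub>1 K\<^sub>1" and 2: "transiso G\<^sub>2 H\<^sub>2 K\<^sub>2"
  shows "transiso (G\<^sub>1 \<times>\<times> G\<^sub>2) (H\<^sub>1 \<times> H\<^sub>2) (K\<^sub>1 \<times> K\<^sub>2)"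
proof -
  obtain S\<^sub>1 T\<^sub>1 f where ST1: "S\<^sub>1 \<in> NRT G\<^sub>1 H\<^sub>1" "T\<^sub>1 \<in> NRT G\<^sub>1 K\<^sub>1"
    and f: "f \<in> iso (NRT_loop G\<^sub>1 H\<^sub>1 S\<^sub>1) (NRT_loop G\<^sub>1 K\<^sub>1 T\<^sub>1)"
    using 1 by (auto simp: transiso_def is_iso_def)
  obtain S\<^sub>2 T\<^sub>2 g where ST2: "S\<^sub>2 \<in> NRT G\<^sub>2 H\<^sub>2" "T\<^sub>2 \<in> NRT G\<^sub>2 K\<^sub>2"
    and g: "g \<in> iso (NRT_loop G\<^sub>2 H\<^sub>2 S\<^sub>2) (NRT_loop G\<^sub>2 K\<^sub>2 T\<^sub>2)"
    using 2 by (auto simp: transiso_def is_iso_def)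
  have bij: "bij_betw (map_prod f g) (S\<^sub>1 \<times> S\<^sub>2) (T\<^sub>1 \<times> T\<^sub>2)"
    using f g by (intro bij_betw_map_prod) (auto simp: iso_def)
  have "map_prod f g \<in> iso (NRT_loop (G\<^sub>1 \<times>\<times> G\<^sub>2) (H\<^sub>1 \<times> H\<^sub>2) (S\<^sub>1 \<times> S\<^sub>2))
      (NRT_loop (G\<^sub>1 \<times>\<times> G\<^sub>2) (K\<^sub>1 \<times> K\<^sub>2) (T\<^sub>1 \<times> T\<^sub>2))"
    using f g bij
    by (auto simp: iso_def hom_def Pi_iff NRT_loop_DirProd_mult[OF G ST1(1) ST2(1)]
        NRT_loop_DirProd_mult[OF G ST1(2) ST2(2)])
  then show ?thesis
    unfolding transiso_def using NRT_DirProd ST1 ST2 is_isoI by blast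
qed

section \<open>Subgroups of a direct product of coprime orders\<close>

lemma DirProd_nat_pow: "(x, y) [^]\<^bsub>G\<^sub>1 \<times>\<times> G\<^sub>2\<^esub> (n::nat) = (x [^]\<^bsub>G\<^sub>1\<^esub> n, y [^]\<^bsub>G\<^sub>2\<^esub> n)"
  by (induction n) simp_all

lemma subgroup_nat_pow_closed:
  assumes "subgroup H G" "x \<in> H"
  shows "x [^]\<^bsub>G\<^esub> (n::nat) \<in> H"
  using assms by (induction n) (auto intro: subgroup.one_closed subgroup.m_closed)

text \<open>Coprimality separates components inside \<open>H\<close>: a suitable power of
  \<open>(a, b)\<close> is \<open>(a, \<one>)\<close>. Any first component can then be paired with
  any second component occurring in \<open>H\<close>.\<close>

lemma subgroup_DirProd_coprime:
  assumes G: "group G\<^sub>1" "group G\<^sub>2" and fin: "finite (carrier G\<^sub>1)" "finite (carrier G\<^sub>2)"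
    and cop: "coprime (order G\<^sub>1) (order G\<^sub>2)"
    and H: "subgroup H (G\<^sub>1 \<times>\<times> G\<^sub>2)"
  shows "subgroup (fst ` H) G\<^sub>1" "subgroup (snd ` H) G\<^sub>2" "H = fst ` H \<times> snd ` H"
proof -
  interpret G1: group G\<^sub>1 by fact
  interpret G2: group G\<^sub>2 by fact
  interpret P: group "G\<^sub>1 \<times>\<times> G\<^sub>2" by (rule DirProd_group[OF G])
  interpret H: subgroup H "G\<^sub>1 \<times>\<times> G\<^sub>2" by fact
  interpret p1: group_hom "G\<^sub>1 \<times>\<times> G\<^sub>2" G\<^sub>1 fst
    by unfold_locales (auto simp: hom_def)
  interpret p2: group_hom "G\<^sub>1 \<times>\<times> G\<^sub>2" G\<^sub>2 snd
    by unfold_locales (auto simp: hom_def)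
  show "subgroup (fst ` H) G\<^sub>1" "subgroup (snd ` H) G\<^sub>2"
    by (simp_all add: H p1.subgroup_img_is_subgroup p2.subgroup_img_is_subgroup)
  \<comment> \<open>\<open>bezout_nat\<close> needs a nonzero first argument; an infinite group
    would have order 0.\<close>
  have "order G\<^sub>2 \<noteq> 0"
    using fin(2) G2.order_gt_0_iff_finite by simp
  \<comment> \<open>This exponent fixes the first component of an element and kills the second.\<close>
  then obtain u v where uv: "order G\<^sub>2 * u = order G\<^sub>1 * v + 1"
    using bezout_nat[of "order G\<^sub>2" "order G\<^sub>1"] cop
    by (metis coprime_commute coprime_imp_gcd_eq_1)
  have left: "(a, \<one>\<^bsub>G\<^sub>2\<^esub>) \<in> H" if ab: "(a, b) \<in> H" for a b
  proof -
    have c: "a \<in> carrier G\<^sub>1" "b \<in> carrier G\<^sub>2"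
      using H.subset ab by auto
    have "(a, b) [^]\<^bsub>G\<^sub>1 \<times>\<times> G\<^sub>2\<^esub> (order G\<^sub>2 * u) \<in> H"
      using subgroup_nat_pow_closed[OF H ab] .
    moreover have "b [^]\<^bsub>G\<^sub>2\<^esub> (order G\<^sub>2 * u) = \<one>\<^bsub>G\<^sub>2\<^esub>"
      using c by (metis G2.nat_pow_pow G2.pow_order_eq_1 G2.nat_pow_one)
    moreover have "a [^]\<^bsub>G\<^sub>1\<^esub> (order G\<^sub>2 * u) = a"
    proof -
      have "a [^]\<^bsub>G\<^sub>1\<^esub> (order G\<^sub>1 * v) = \<one>\<^bsub>G\<^sub>1\<^esub>"
        using c by (metis G1.nat_pow_pow G1.pow_order_eq_1 G1.nat_pow_one)
      then show ?thesis using c by (simp add: uv)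
    qed
    ultimately show ?thesis by (simp add: DirProd_nat_pow)
  qed
  have mix: "(a, b') \<in> H" if ab: "(a, b) \<in> H" "(a', b') \<in> H" for a b a' b'
  proof -
    have c: "a \<in> carrier G\<^sub>1" "a' \<in> carrier G\<^sub>1" "b' \<in> carrier G\<^sub>2"
      using H.subset ab by auto
    \<comment> \<open>Cancelling \<open>a'\<close> on the left of \<open>(a', b')\<close> isolates
      \<open>b'\<close>, so no second exponent for the other factor is required.\<close>
    have "inv\<^bsub>G\<^sub>1 \<times>\<times> G\<^sub>2\<^esub> (a', \<one>\<^bsub>G\<^sub>2\<^esub>) \<in> H"
      using H.m_inv_closed[OF left[OF ab(2)]] .
    then have "(inv\<^bsub>G\<^sub>1\<^esub> a', \<one>\<^bsub>G\<^sub>2\<^esub>) \<in> H"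
      using G c by simp
    from H.m_closed[OF this ab(2)] have "(\<one>\<^bsub>G\<^sub>1\<^esub>, b') \<in> H"
      using c by simp
    from H.m_closed[OF left[OF ab(1)] this] show ?thesis
      using c by simp
  qed
  have "fst ` H \<times> snd ` H \<subseteq> H"
    by (clarify, rule mix) simp_all
  then show "H = fst ` H \<times> snd ` H"
    using subset_fst_snd by (rule subset_antisym[rotated])
qed

text \<open>As a divisor of \<open>m\<close>, \<open>a\<close> is coprime to \<open>d\<close> and so
  divides \<open>c\<close>; by symmetry \<open>c\<close> divides \<open>a\<close>. This recovers the
  orders of the projections from the order of the subgroup.\<close>

lemma mult_eq_mult_coprime_nat:
  fixes a b c d m n :: nat
  assumes "a * b = c * d" "a dvd m" "c dvd m" "b dvd n" "d dvd n" "coprime m n"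
  shows "a = c"
proof -
  have "coprime a d" "coprime c b"
    using coprime_divisors[OF assms(2,5,6)] coprime_divisors[OF assms(3,4,6)] by auto
  moreover have "a dvd c * d" "c dvd a * b"
    using dvd_triv_left[of a b] dvd_triv_left[of c d] by (simp_all add: assms(1))
  ultimately show ?thesis
    by (simp add: coprime_dvd_mult_left_iff dvd_antisym)
qed

theorem proposition2p10:
  fixes G\<^sub>1 :: "('a, 'c) monoid_scheme" and G\<^sub>2 :: "('b, 'd) monoid_scheme"
  assumes "t_group G\<^sub>1" and "t_group G\<^sub>2"
    and "gcd (order G\<^sub>1) (order G\<^sub>2) = 1"
  shows "t_group (G\<^sub>1 \<times>\<times> G\<^sub>2)"
proof -
  have G: "group G\<^sub>1" "group G\<^sub>2" and fin: "finite (carrier G\<^sub>1)" "finite (carrier G\<^sub>2)"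
    and t1: "\<And>H K. subgroup H G\<^sub>1 \<Longrightarrow> subgroup K G\<^sub>1 \<Longrightarrow> card H = card K \<Longrightarrow> transiso G\<^sub>1 H K"
    and t2: "\<And>H K. subgroup H G\<^sub>2 \<Longrightarrow> subgroup K G\<^sub>2 \<Longrightarrow> card H = card K \<Longrightarrow> transiso G\<^sub>2 H K"
    using assms(1,2) by (auto simp: t_group_iff)
  have cop: "coprime (order G\<^sub>1) (order G\<^sub>2)"
    using assms(3) by (simp add: coprime_iff_gcd_eq_1)
  note split = subgroup_DirProd_coprime[OF G fin cop]
  have dvd: "card (fst ` H) dvd order G\<^sub>1" "card (snd ` H) dvd order G\<^sub>2"
    if "subgroup H (G\<^sub>1 \<times>\<times> G\<^sub>2)" for H
    using group.lagrange[OF G(1) split(1)[OF that]] group.lagrange[OF G(2) split(2)[OF that]]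
    by (metis dvd_triv_right)+
  have "transiso (G\<^sub>1 \<times>\<times> G\<^sub>2) H K"
    if H: "subgroup H (G\<^sub>1 \<times>\<times> G\<^sub>2)" and K: "subgroup K (G\<^sub>1 \<times>\<times> G\<^sub>2)" and card: "card H = card K"
    for H K
  proof -
    have eq: "card (fst ` H) * card (snd ` H) = card (fst ` K) * card (snd ` K)"
      using card by (simp flip: card_cartesian_product split(3)[OF H] split(3)[OF K])
    have "card (fst ` H) = card (fst ` K)"
      using mult_eq_mult_coprime_nat[OF eq] dvd[OF H] dvd[OF K] cop by blast
    \<comment> \<open>The same argument with the two factors and the two group orders
      exchanged.\<close>
    moreover have "card (snd ` H) = card (snd ` K)"
      using mult_eq_mult_coprime_nat[OF eq[unfolded mult.commute[of "card (fst ` _)"]]]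
        dvd[OF H] dvd[OF K] cop by (simp add: coprime_commute)
    ultimately have "transiso (G\<^sub>1 \<times>\<times> G\<^sub>2) (fst ` H \<times> snd ` H) (fst ` K \<times> snd ` K)"
      using H K by (intro transiso_DirProd G t1 t2 split)
    then show ?thesis
      by (simp flip: split(3)[OF H] split(3)[OF K])
  qed
  then show ?thesis
    using DirProd_group[OF G] fin by (simp add: t_group_iff)
qed

end
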